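(* Let $X,Z$ be complex Hilbert spaces, let $E\in L(X,Z)$, let $A\colon\mathrm{dom}(A)\subseteq X\to Z$ be closed and densely defined, assume $\rho(E,A)\neq\emptyset$, and let $\mu\in\rho(E,A)$. Then $E\in L(X,Z_{-1})$ and $A$ has a unique extension $A_{-1}\in L(X,Z_{-1})$. Furthermore, $\mu\in\rho(E,A_{-1})$ and $(\mu E-A_{-1})^{-1}\in L(Z_{-1},X)$.
   Context: $L(X,Z)$ denotes the bounded linear operators from $X$ to $Z$. $\rho(E,A)$ is the set of all $\lambda\in\mathbb{C}$ such that $\lambda E-A\colon\mathrm{dom}(A)\to Z$ is bijective with $(\lambda E-A)^{-1}\in L(Z,X)$. $Z_{-1}$ is the completion of $Z$ with respect to the norm $\|z\|_{Z_{-1}}=\|(\mu E-A)^{-1}z\|_X$ for some $\mu\in\rho(E,A)$; different choices of $\mu\in\rho(E,A)$ yield equivalent norms and hence the same space. $\rho(E,A_{-1})$ is the set of all $\lambda\in\mathbb{C}$ such that $\lambda E-A_{-1}\colon X\to Z_{-1}$ is bijective with bounded inverse. *)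

theory Defs
  imports "HOL-Analysis.Analysis"
begin

class complex_normed_vector = real_normed_vector +
  fixes scaleC :: "complex \<Rightarrow> 'a \<Rightarrow> 'a"  (infixr \<open>*\<^sub>C\<close> 75)
  assumes scaleC_add_right: "a *\<^sub>C (x + y) = a *\<^sub>C x + a *\<^sub>C y"
    and scaleC_add_left: "(a + b) *\<^sub>C x = a *\<^sub>C x + b *\<^sub>C x"
    and scaleC_scaleC: "a *\<^sub>C (b *\<^sub>C x) = (a * b) *\<^sub>C x"
    and scaleC_of_real: "complex_of_real r *\<^sub>C x = r *\<^sub>R x"
    and norm_scaleC: "norm (a *\<^sub>C x) = cmod a * norm x"

class complex_banach = complex_normed_vector + banach

text \<open>
  The inner product is linear in its second argument. Positive definiteness is contained in the
  last axiom, which says that the norm is the one induced by the inner product.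
\<close>

class complex_hilbert = complex_banach +
  fixes cinner :: "'a \<Rightarrow> 'a \<Rightarrow> complex"
  assumes cinner_commute: "cinner x y = cnj (cinner y x)"
    and cinner_add_right: "cinner x (y + z) = cinner x y + cinner x z"
    and cinner_scaleC_right: "cinner x (a *\<^sub>C y) = a * cinner x y"
    and cinner_self: "cinner x x = complex_of_real ((norm x)\<^sup>2)"

instantiation complex :: complex_hilbert
begin

definition scaleC_complex :: "complex \<Rightarrow> complex \<Rightarrow> complex" where
  "scaleC_complex a x = a * x"

definition cinner_complex :: "complex \<Rightarrow> complex \<Rightarrow> complex" where
  "cinner_complex x y = cnj x * y"

instance
  by standard
    (auto simp: scaleC_complex_def cinner_complex_def algebra_simps norm_mult scaleR_conv_of_real
      complex_norm_square simp flip: of_real_power)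

end

definition bounded_clinear ::
    "('a::complex_normed_vector \<Rightarrow> 'b::complex_normed_vector) \<Rightarrow> bool" where
  "bounded_clinear f \<longleftrightarrow> bounded_linear f \<and> (\<forall>c x. f (c *\<^sub>C x) = c *\<^sub>C f x)"

text \<open>
  A possibly unbounded operator is given by its domain \<open>D\<close> together with a total function \<open>A\<close>.
  The values of \<open>A\<close> outside \<open>D\<close> are irrelevant: every notion below only uses \<open>A\<close> on \<open>D\<close>.
\<close>

definition clinear_on ::
    "'a::complex_normed_vector set \<Rightarrow> ('a \<Rightarrow> 'b::complex_normed_vector) \<Rightarrow> bool" where
  "clinear_on D A \<longleftrightarrow>
     0 \<in> D \<and>
     (\<forall>x\<in>D. \<forall>y\<in>D. x + y \<in> D \<and> A (x + y) = A x + A y) \<and>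
     (\<forall>c. \<forall>x\<in>D. c *\<^sub>C x \<in> D \<and> A (c *\<^sub>C x) = c *\<^sub>C A x)"

definition closed_operator ::
    "'a::complex_normed_vector set \<Rightarrow> ('a \<Rightarrow> 'b::complex_normed_vector) \<Rightarrow> bool" where
  "closed_operator D A \<longleftrightarrow> closed ((\<lambda>x. (x, A x)) ` D)"

definition densely_defined :: "'a::complex_normed_vector set \<Rightarrow> bool" where
  "densely_defined D \<longleftrightarrow> closure D = UNIV"

definition pencil_inverse ::
    "('a::complex_normed_vector \<Rightarrow> 'b::complex_normed_vector) \<Rightarrow> 'a set \<Rightarrow> ('a \<Rightarrow> 'b) \<Rightarrow>
      complex \<Rightarrow> 'b \<Rightarrow> 'a" where
  "pencil_inverse E D A \<mu> = inv_into D (\<lambda>x. \<mu> *\<^sub>C E x - A x)"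

definition resolvent_set ::
    "('a::complex_normed_vector \<Rightarrow> 'b::complex_normed_vector) \<Rightarrow> 'a set \<Rightarrow> ('a \<Rightarrow> 'b) \<Rightarrow>
      complex set" where
  "resolvent_set E D A =
     {\<mu>. bij_betw (\<lambda>x. \<mu> *\<^sub>C E x - A x) D UNIV \<and> bounded_clinear (pencil_inverse E D A \<mu>)}"

text \<open>
  A completion of a complex vector space with respect to a norm \<open>N\<close> (given as a function, and
  different from the norm of the type) is a Banach space together with a linear embedding
  \<open>j\<close> that carries \<open>N\<close> to the norm of the Banach space and has dense range. It is determined up
  to isometric isomorphism.
\<close>

definition is_completion ::
    "('b::complex_normed_vector \<Rightarrow> real) \<Rightarrow> ('b \<Rightarrow> 'w::complex_banach) \<Rightarrow> bool" where
  "is_completion N j \<longleftrightarrow>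
     clinear_on UNIV j \<and> (\<forall>z. norm (j z) = N z) \<and> closure (range j) = UNIV"

definition extrapolation_norm ::
    "('a::complex_normed_vector \<Rightarrow> 'b::complex_normed_vector) \<Rightarrow> 'a set \<Rightarrow> ('a \<Rightarrow> 'b) \<Rightarrow>
      complex \<Rightarrow> 'b \<Rightarrow> real" where
  "extrapolation_norm E D A \<mu> z = norm (pencil_inverse E D A \<mu> z)"

text \<open>
  Completions with respect to the extrapolation norm always exist: the space \<open>X\<close> itself, with the
  resolvent as the embedding, is one.
\<close>

lemma is_completion_pencil_inverse:
  fixes E A :: "'x::complex_hilbert \<Rightarrow> 'z::complex_hilbert"
  assumes "densely_defined D" and \<mu>: "\<mu> \<in> resolvent_set E D A"
  shows "is_completion (extrapolation_norm E D A \<mu>) (pencil_inverse E D A \<mu>)"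
proof -
  have "bij_betw (pencil_inverse E D A \<mu>) UNIV D"
    using \<mu> by (simp add: resolvent_set_def pencil_inverse_def bij_betw_inv_into)
  then have "closure (range (pencil_inverse E D A \<mu>)) = UNIV"
    using assms(1) by (simp add: bij_betw_def densely_defined_def)
  moreover have "bounded_clinear (pencil_inverse E D A \<mu>)"
    using \<mu> by (simp add: resolvent_set_def)
  ultimately show ?thesis
    by (simp add: is_completion_def clinear_on_def bounded_clinear_def extrapolation_norm_def
        linear_add bounded_linear.linear)
qed

definition is_bounded_extension ::
    "('b::complex_normed_vector \<Rightarrow> 'w::complex_normed_vector) \<Rightarrow> 'a::complex_normed_vector set \<Rightarrow>
      ('a \<Rightarrow> 'b) \<Rightarrow> ('a \<Rightarrow> 'w) \<Rightarrow> bool" where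
  "is_bounded_extension j D A B \<longleftrightarrow> bounded_clinear B \<and> (\<forall>x\<in>D. B x = j (A x))"

end

theory Submission
  imports Defs
begin

text \<open>
  The map \<open>\<nu>E - A\<close>, followed by \<open>j\<close>, is isometric from \<open>dom(A)\<close> with the norm of \<open>X\<close> to \<open>Z\<^sub>-\<^sub>1\<close> and has
  dense range, so it extends to an isometric isomorphism \<open>V\<close> from \<open>X\<close> onto \<open>Z\<^sub>-\<^sub>1\<close>. With
  \<open>R\<^sub>\<lambda> = (\<lambda>E - A)\<^sup>-\<^sup>1\<close> this gives \<open>j = V R\<^sub>\<nu>\<close>, so the extension of \<open>A\<close> is \<open>\<nu>jE - V\<close>, and
  \<open>\<mu>jE - A\<^sub>-\<^sub>1 = V (I + (\<mu> - \<nu>) R\<^sub>\<nu> E)\<close>. By the resolvent identity the second factor has the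
  inverse \<open>I + (\<nu> - \<mu>) R\<^sub>\<mu> E\<close>.
\<close>

section \<open>Complex-linear and bounded operators\<close>

interpretation complex_vector: vector_space "scaleC :: complex \<Rightarrow> 'a \<Rightarrow> 'a::complex_normed_vector"
proof
  \<comment> \<open>The unit law is no axiom of the class; it is compatibility with real scaling at
    r = 1.\<close>
  show "1 *\<^sub>C x = x" for x :: 'a
    using scaleC_of_real[of 1 x] by simp
qed (simp_all add: scaleC_add_right scaleC_add_left scaleC_scaleC)

lemma bounded_clinearI:
  assumes "\<And>x y. f (x + y) = f x + f y"
    and "\<And>c x. f (c *\<^sub>C x) = c *\<^sub>C f x"
    and "\<And>x. norm (f x) \<le> norm x * K"
  shows "bounded_clinear f"
proof -
  have "f (r *\<^sub>R x) = r *\<^sub>R f x" for r x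
    using assms(2)[of "complex_of_real r" x] by (simp add: scaleC_of_real)
  then show ?thesis
    unfolding bounded_clinear_def using assms bounded_linear_intro[of f K] by blast
qed

lemma bounded_clinear_simps:
  assumes "bounded_clinear f"
  shows "f (x + y) = f x + f y" "f (x - y) = f x - f y" "f (c *\<^sub>C x) = c *\<^sub>C f x"
  using assms
  by (simp_all add: bounded_clinear_def linear_add linear_diff bounded_linear.linear)

lemma bounded_clinear_compose:
  "bounded_clinear f \<Longrightarrow> bounded_clinear g \<Longrightarrow> bounded_clinear (\<lambda>x. f (g x))"
  by (simp add: bounded_clinear_def bounded_linear_compose)

lemma bounded_clinear_add:
  "bounded_clinear f \<Longrightarrow> bounded_clinear g \<Longrightarrow> bounded_clinear (\<lambda>x. f x + g x)"
  by (simp add: bounded_clinear_def bounded_linear_add scaleC_add_right)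

lemma bounded_clinear_diff:
  "bounded_clinear f \<Longrightarrow> bounded_clinear g \<Longrightarrow> bounded_clinear (\<lambda>x. f x - g x)"
  by (simp add: bounded_clinear_def bounded_linear_sub complex_vector.scale_right_diff_distrib)

lemma bounded_clinear_scaleC: "bounded_clinear (scaleC c)"
  by (rule bounded_clinearI[of _ "cmod c"])
    (simp_all add: scaleC_add_right norm_scaleC mult.commute)

lemma continuous_on_bounded_clinear: "bounded_clinear f \<Longrightarrow> continuous_on S f"
  by (simp add: bounded_clinear_def linear_continuous_on)

lemma continuous_on_scaleC [continuous_intros]:
  "continuous_on S f \<Longrightarrow> continuous_on S (\<lambda>x. c *\<^sub>C f x)"
  using continuous_on_compose2[OF continuous_on_bounded_clinear[OF bounded_clinear_scaleC]]
  by blast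

lemma clinear_on_diff:
  assumes "clinear_on D f" "x \<in> D" "y \<in> D"
  shows "x - y \<in> D \<and> f (x - y) = f x - f y"
proof -
  have "(-1) *\<^sub>C y \<in> D \<and> f ((-1) *\<^sub>C y) = (-1) *\<^sub>C f y"
    using assms unfolding clinear_on_def by blast
  then have "- y \<in> D \<and> f (- y) = - f y"
    by simp
  then have "x + - y \<in> D \<and> f (x + - y) = f x + - f y"
    using assms unfolding clinear_on_def by metis
  then show ?thesis by simp
qed

lemma clinear_on_compose:
  assumes "clinear_on D f" "clinear_on UNIV g"
  shows "clinear_on D (\<lambda>x. g (f x))"
  using assms by (simp add: clinear_on_def)

section \<open>Extension from a dense domain\<close>

text \<open>The set of points of agreement is closed and contains \<open>D\<close>. This carries
  identities from the domain to a continuous extension and makes such extensions unique.\<close>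

lemma continuous_eq_on_dense:
  fixes f g :: "'a::topological_space \<Rightarrow> 'b::real_normed_vector"
  assumes "continuous_on UNIV f" "continuous_on UNIV g" "closure D = UNIV"
    and "\<And>x. x \<in> D \<Longrightarrow> f x = g x"
  shows "f x = g x"
proof -
  have "closed {x. f x = g x}"
    using assms by (intro closed_Collect_eq)
  moreover have "D \<subseteq> {x. f x = g x}"
    using assms by blast
  ultimately have "closure D \<subseteq> {x. f x = g x}"
    by (intro closure_minimal)
  then show ?thesis using assms by auto
qed

text \<open>An isometry is uniformly continuous, so it extends to the closure of its domain; the
  norm identity and linearity pass to the limit by density.\<close>

lemma clinear_isometry_extension:
  fixes f :: "'a::complex_banach \<Rightarrow> 'b::complex_banach"
  assumes lin: "clinear_on D f" and dense: "closure D = UNIV"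
    and iso: "\<And>x. x \<in> D \<Longrightarrow> norm (f x) = norm x"
    and range: "closure (f ` D) = UNIV"
  obtains V where "bounded_clinear V" "bij V" "bounded_clinear (inv V)"
    "\<And>x. x \<in> D \<Longrightarrow> V x = f x"
proof -
  have dist: "dist (f x) (f y) = dist x y" if "x \<in> D" "y \<in> D" for x y
    using clinear_on_diff[OF lin that] iso by (metis dist_norm)
  then have "uniformly_continuous_on D f"
    unfolding uniformly_continuous_on_def by metis
  then obtain V where V: "uniformly_continuous_on (closure D) V" and ext: "\<And>x. x \<in> D \<Longrightarrow> V x = f x"
    by (metis uniformly_continuous_on_extension_on_closure)
  have cont: "continuous_on UNIV V"
    using V dense by (metis uniformly_continuous_imp_continuous)
  note [continuous_intros] = continuous_on_compose2[OF cont _ subset_UNIV]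
  have norm_V: "norm (V x) = norm x" for x
    by (rule continuous_eq_on_dense[OF _ _ dense]) (auto intro!: continuous_intros simp: ext iso)
  \<comment> \<open>Additivity involves two variables, so the density argument is run on
    pairs.\<close>
  have dense2: "closure (D \<times> D) = UNIV"
    by (simp add: closure_Times dense)
  have add: "V (x + y) = V x + V y" for x y
  proof -
    have "V (fst p + snd p) = V (fst p) + V (snd p)" for p
      by (rule continuous_eq_on_dense[OF _ _ dense2])
        (use lin in \<open>auto intro!: continuous_intros simp: ext clinear_on_def\<close>)
    from this[of "(x, y)"] show ?thesis by simp
  qed
  have scale: "V (c *\<^sub>C x) = c *\<^sub>C V x" for c x
    by (rule continuous_eq_on_dense[OF _ _ dense])
      (use lin in \<open>auto intro!: continuous_intros simp: ext clinear_on_def\<close>)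
  have bV: "bounded_clinear V"
    by (rule bounded_clinearI[of _ 1]) (simp_all add: add scale norm_V)
  have dist_V: "dist (V x) (V y) = dist x y" for x y
    by (metis bounded_clinear_simps(2)[OF bV] dist_norm norm_V)
  then have "inj V"
    by (metis injI dist_eq_0_iff)
  have "complete (range V)"
  proof (rule complete_isometric_image[of 1])
    show "bounded_linear V"
      using bV by (simp add: bounded_clinear_def)
  qed (simp_all add: norm_V complete_UNIV)
  then have "closed (range V)"
    by (rule complete_imp_closed)
  moreover have "f ` D \<subseteq> range V"
    using ext by (metis image_subsetI rangeI)
  ultimately have "surj V"
    using range closure_minimal by (metis top.extremum_uniqueI)
  with \<open>inj V\<close> have "bij V" by (simp add: bij_def)
  have inv: "V (inv V w) = w" for w
    using \<open>surj V\<close> by (simp add: surj_f_inv_f)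
  have "bounded_clinear (inv V)"
  proof (rule bounded_clinearI[of _ 1])
    show "inv V (v + w) = inv V v + inv V w" for v w
      by (rule injD[OF \<open>inj V\<close>]) (simp add: inv add)
    show "inv V (c *\<^sub>C w) = c *\<^sub>C inv V w" for c w
      by (rule injD[OF \<open>inj V\<close>]) (simp add: inv scale)
    show "norm (inv V w) \<le> norm w * 1" for w
      using norm_V[of "inv V w"] inv by simp
  qed
  with bV \<open>bij V\<close> ext that show thesis by blast
qed

section \<open>Operator pencils and their resolvents\<close>

lemma clinear_on_pencil:
  assumes "bounded_clinear E" "clinear_on D A"
  shows "clinear_on D (\<lambda>x. \<mu> *\<^sub>C E x - A x)"
  using assms(2) bounded_clinear_simps[OF assms(1)]
  by (auto simp: clinear_on_def scaleC_add_right complex_vector.scale_right_diff_distrib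
      scaleC_scaleC mult.commute)

lemma
  assumes "\<mu> \<in> resolvent_set E D A"
  shows pencil_inverse_in_domain: "pencil_inverse E D A \<mu> z \<in> D"
    and pencil_pencil_inverse:
      "\<mu> *\<^sub>C E (pencil_inverse E D A \<mu> z) - A (pencil_inverse E D A \<mu> z) = z"
    and pencil_inverse_pencil: "x \<in> D \<Longrightarrow> pencil_inverse E D A \<mu> (\<mu> *\<^sub>C E x - A x) = x"
    and bounded_clinear_pencil_inverse: "bounded_clinear (pencil_inverse E D A \<mu>)"
proof -
  have bij: "bij_betw (\<lambda>x. \<mu> *\<^sub>C E x - A x) D UNIV"
    using assms by (simp add: resolvent_set_def)
  then show "pencil_inverse E D A \<mu> z \<in> D"
    unfolding pencil_inverse_def by (metis UNIV_I bij_betw_imp_surj_on inv_into_into)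
  show "\<mu> *\<^sub>C E (pencil_inverse E D A \<mu> z) - A (pencil_inverse E D A \<mu> z) = z"
    unfolding pencil_inverse_def using bij_betw_inv_into_right[OF bij] by simp
  show "x \<in> D \<Longrightarrow> pencil_inverse E D A \<mu> (\<mu> *\<^sub>C E x - A x) = x"
    unfolding pencil_inverse_def using bij_betw_inv_into_left[OF bij] by simp
  show "bounded_clinear (pencil_inverse E D A \<mu>)"
    using assms by (simp add: resolvent_set_def)
qed

text \<open>With x = \<open>?R \<nu> z\<close>, write z = (\<nu>E - A)x as (\<mu>E - A)x + (\<nu> -
  \<mu>)Ex and apply \<open>?R \<mu>\<close>.\<close>

lemma resolvent_identity:
  assumes "\<mu> \<in> resolvent_set E D A" "\<nu> \<in> resolvent_set E D A"
  shows "pencil_inverse E D A \<mu> z - pencil_inverse E D A \<nu> z =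
    (\<nu> - \<mu>) *\<^sub>C pencil_inverse E D A \<mu> (E (pencil_inverse E D A \<nu> z))"
proof -
  let ?R = "pencil_inverse E D A"
  let ?x = "?R \<nu> z"
  have "z = \<nu> *\<^sub>C E ?x - A ?x"
    using pencil_pencil_inverse[OF assms(2)] by simp
  also have "\<dots> = (\<mu> *\<^sub>C E ?x - A ?x) + (\<nu> - \<mu>) *\<^sub>C E ?x"
    by (simp add: complex_vector.scale_left_diff_distrib)
  finally have "?R \<mu> z = ?R \<mu> ((\<mu> *\<^sub>C E ?x - A ?x) + (\<nu> - \<mu>) *\<^sub>C E ?x)"
    by simp
  also have "\<dots> = ?x + (\<nu> - \<mu>) *\<^sub>C ?R \<mu> (E ?x)"
    using pencil_inverse_in_domain[OF assms(2)]
    by (simp only: bounded_clinear_simps(1,3)[OF bounded_clinear_pencil_inverse[OF assms(1)]]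
        pencil_inverse_pencil[OF assms(1)])
  finally show ?thesis by simp
qed

text \<open>The resolvent identity collapses \<open>?R \<mu> (E y)\<close> to
  \<open>?R \<nu> (E x)\<close>, and the two correction terms then cancel. Exchanging \<mu> and
  \<nu> gives the inverse on the other side.\<close>

lemma resolvent_factor_inverse:
  assumes "bounded_clinear E" "\<mu> \<in> resolvent_set E D A" "\<nu> \<in> resolvent_set E D A"
    and "y = x + (\<mu> - \<nu>) *\<^sub>C pencil_inverse E D A \<nu> (E x)"
  shows "y + (\<nu> - \<mu>) *\<^sub>C pencil_inverse E D A \<mu> (E y) = x"
proof -
  let ?R = "pencil_inverse E D A"
  have "?R \<mu> (E y) = ?R \<mu> (E x) + (\<mu> - \<nu>) *\<^sub>C ?R \<mu> (E (?R \<nu> (E x)))"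
    unfolding assms(4)
    by (simp add: bounded_clinear_simps[OF assms(1)]
        bounded_clinear_simps[OF bounded_clinear_pencil_inverse[OF assms(2)]])
  also have "\<dots> = ?R \<mu> (E x) - (\<nu> - \<mu>) *\<^sub>C ?R \<mu> (E (?R \<nu> (E x)))"
    by (simp add: complex_vector.scale_left_diff_distrib)
  also have "\<dots> = ?R \<nu> (E x)"
    by (simp flip: resolvent_identity[OF assms(2,3)])
  finally show ?thesis
    unfolding assms(4) by (simp add: complex_vector.scale_left_diff_distrib)
qed

section \<open>The extension of \<open>A\<close> to all of X and its resolvent\<close>

theorem lemma2p3:
  fixes E A :: "'x::complex_hilbert \<Rightarrow> 'z::complex_hilbert"
    and D :: "'x set"
    and \<mu> \<nu> :: complex
    and j :: "'z \<Rightarrow> 'w::complex_banach"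
  assumes "bounded_clinear E"
    and "clinear_on D A"
    and "closed_operator D A"
    and "densely_defined D"
    and "\<nu> \<in> resolvent_set E D A"
    and "is_completion (extrapolation_norm E D A \<nu>) j"
    and "\<mu> \<in> resolvent_set E D A"
  shows "bounded_clinear (j \<circ> E) \<and>
    (\<exists>!B. is_bounded_extension j D A B) \<and>
    (\<forall>B. is_bounded_extension j D A B \<longrightarrow>
      \<mu> \<in> resolvent_set (j \<circ> E) UNIV B \<and>
      bounded_clinear (pencil_inverse (j \<circ> E) UNIV B \<mu>))"
proof -
  let ?R = "pencil_inverse E D A"
  note E = assms(1) and \<nu> = assms(5) and \<mu> = assms(7)
  have j_lin: "clinear_on UNIV j" and j_norm: "\<And>z. norm (j z) = norm (?R \<nu> z)"
    and j_dense: "closure (range j) = UNIV"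
    using assms(6) by (auto simp: is_completion_def extrapolation_norm_def)
  have dense: "closure D = UNIV"
    using assms(4) by (simp add: densely_defined_def)
  \<comment> \<open>The pencil is taken at \<nu>, not \<mu>, because the norm of the completion is
    built from \<open>?R \<nu>\<close>; this makes \<open>f\<close> isometric on
    \<open>D\<close>.\<close>
  define f where "f x = j (\<nu> *\<^sub>C E x - A x)" for x
  have f_lin: "clinear_on D f"
    unfolding f_def by (rule clinear_on_compose[OF clinear_on_pencil[OF assms(1,2)] j_lin])
  have f_norm: "norm (f x) = norm x" if "x \<in> D" for x
    using that by (simp add: f_def j_norm pencil_inverse_pencil[OF \<nu>])
  have f_R: "f (?R \<nu> z) = j z" for z
    by (simp add: f_def pencil_pencil_inverse[OF \<nu>])
  have "j z \<in> f ` D" for z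
    using imageI[OF pencil_inverse_in_domain[OF \<nu>], of f z] by (simp only: f_R)
  then have "range j \<subseteq> f ` D"
    by blast
  then have "closure (f ` D) = UNIV"
    using j_dense closure_mono[of "range j" "f ` D"] by auto
  from clinear_isometry_extension[OF f_lin dense f_norm this]
  obtain V where V: "bounded_clinear V" "bij V" "bounded_clinear (inv V)"
    and V_f: "\<And>x. x \<in> D \<Longrightarrow> V x = f x"
    by blast
  \<comment> \<open>This factorisation shows that \<open>j\<close> is bounded for the original norm
    of Z, and hence so is \<open>j \<circ> E\<close>.\<close>
  have j_V: "j z = V (?R \<nu> z)" for z
    by (simp add: V_f f_R pencil_inverse_in_domain[OF \<nu>])
  have jE: "bounded_clinear (j \<circ> E)"
    unfolding comp_def j_V
    by (intro bounded_clinear_compose[OF V(1)]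
        bounded_clinear_compose[OF bounded_clinear_pencil_inverse[OF \<nu>]] E)
  define B where "B x = \<nu> *\<^sub>C j (E x) - V x" for x
  have ext: "is_bounded_extension j D A B"
    unfolding is_bounded_extension_def
  proof
    show "bounded_clinear B"
      unfolding B_def
      by (intro bounded_clinear_diff bounded_clinear_compose[OF bounded_clinear_scaleC]
          jE[unfolded comp_def] V)
    show "\<forall>x\<in>D. B x = j (A x)"
    proof
      fix x assume "x \<in> D"
      have "f x = j (\<nu> *\<^sub>C E x) - j (A x)"
        using clinear_on_diff[OF j_lin] by (simp add: f_def)
      also have "j (\<nu> *\<^sub>C E x) = \<nu> *\<^sub>C j (E x)"
        using j_lin by (simp add: clinear_on_def)
      finally show "B x = j (A x)"
        using \<open>x \<in> D\<close> by (simp add: B_def V_f)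
    qed
  qed
  \<comment> \<open>Uniqueness also reduces the claim about every bounded extension to this
    \<open>B\<close>.\<close>
  have unique: "B' = B" if "is_bounded_extension j D A B'" for B'
  proof
    show "B' x = B x" for x
      by (rule continuous_eq_on_dense[of B' B, OF _ _ dense])
        (use that ext in \<open>auto simp: is_bounded_extension_def continuous_on_bounded_clinear\<close>)
  qed
  define S T where "S x = x + (\<mu> - \<nu>) *\<^sub>C ?R \<nu> (E x)"
    and "T x = x + (\<nu> - \<mu>) *\<^sub>C ?R \<mu> (E x)" for x
  \<comment> \<open>Inserting \<open>B\<close> leaves V x + (\<mu> - \<nu>) j(Ex); factoring
    \<open>j\<close> through \<open>V\<close> lets \<open>V\<close> be pulled out.\<close>
  have pencil: "\<mu> *\<^sub>C (j \<circ> E) x - B x = V (S x)" for x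
    by (simp add: B_def S_def j_V bounded_clinear_simps[OF V(1)]
        complex_vector.scale_left_diff_distrib)
  have TS: "T (S x) = x" and ST: "S (T x) = x" for x
    using resolvent_factor_inverse[OF E \<mu> \<nu> S_def] resolvent_factor_inverse[OF E \<nu> \<mu> T_def]
    unfolding S_def T_def by blast+
  have V_inv: "V (inv V w) = w" "inv V (V x) = x" for w x
    using V(2) by (simp_all add: bij_is_surj surj_f_inv_f bij_is_inj)
  have bij: "bij (\<lambda>x. V (S x))"
    by (rule bij_betw_byWitness[where f' = "\<lambda>w. T (inv V w)"]) (auto simp: TS ST V_inv)
  \<comment> \<open>The inverse is exhibited explicitly, so its boundedness follows from that of
    \<open>inv V\<close>, \<open>?R \<mu>\<close> and \<open>E\<close>.\<close>
  have "inv (\<lambda>x. V (S x)) = (\<lambda>w. T (inv V w))"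
    by (rule inv_equality) (simp_all add: TS ST V_inv)
  moreover have "bounded_clinear (\<lambda>w. T (inv V w))"
    unfolding T_def
    by (intro bounded_clinear_add V bounded_clinear_compose[OF bounded_clinear_scaleC]
        bounded_clinear_compose[OF bounded_clinear_pencil_inverse[OF \<mu>]]
        bounded_clinear_compose[OF E])
  ultimately have inverse: "bounded_clinear (pencil_inverse (j \<circ> E) UNIV B \<mu>)"
    unfolding pencil_inverse_def pencil by simp
  with bij have "\<mu> \<in> resolvent_set (j \<circ> E) UNIV B"
    unfolding resolvent_set_def mem_Collect_eq pencil by blast
  with inverse ext unique jE show ?thesis
    by blast
qed

end
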